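(* Let $\mathbf{k}$ be a field and let $\Omega$ and $X$ be nonempty sets. The pair $(\mathbf{k}_{\mathrm{NC},\Omega}\{X\},D_\Omega)$, with the natural injection $i:X\to\mathbf{k}_{\mathrm{NC},\Omega}\{X\}$, $x\mapsto(1,x)$, is the free noncommuting multi-differential commutative algebra on $X$ with its noncommuting derivation set $D_\Omega=\{D_\omega\mid\omega\in\Omega\}$.
   Context: By a commutative algebra is meant a commutative associative $\mathbf{k}$-algebra. A *noncommuting multi-differential commutative algebra* indexed by $\Omega$ is a commutative algebra $A$ equipped with a family $\delta_\Omega=\{\delta_\omega\mid\omega\in\Omega\}$ of derivations ($\mathbf{k}$-linear maps satisfying the Leibniz rule $d(xy)=d(x)y+x\,d(y)$) which are not necessarily pairwise commuting. A homomorphism $(R,\partial_\Omega)\to(S,\delta_\Omega)$ is an algebra homomorphism $f:R\to S$ with $f\circ\partial_\omega=\delta_\omega\circ f$ for all $\omega\in\Omega$. Being free on $X$ means: for every noncommuting multi-differential commutative algebra $(A,\delta_\Omega)$ indexed by $\Omega$ and every set map $f:X\to A$ there is a unique homomorphism $\bar f$ from the free object to $(A,\delta_\Omega)$ with $\bar f\circ i=f$. Let $M_{\mathrm{NC}}(\partial_\Omega)$ be the free (noncommutative) monoid of words $\partial_{\omega_1}\cdots\partial_{\omega_k}$, $k\ge0$, on the set of symbols $\partial_\Omega=\{\partial_\omega\mid\omega\in\Omega\}$, with unit $1$ the empty word, and $\Delta_{\mathrm{NC},\Omega}(X):=M_{\mathrm{NC}}(\partial_\Omega)\times X$; write $(\partial_{\omega_1}\cdots\partial_{\omega_k})(x)$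 for $(\partial_{\omega_1}\cdots\partial_{\omega_k},x)$. Let $\mathbf{k}_{\mathrm{NC},\Omega}\{X\}:=\mathbf{k}[\Delta_{\mathrm{NC},\Omega}(X)]$ be the commutative polynomial algebra on this set of variables, that is, the vector space spanned by the free commutative monoid on $\Delta_{\mathrm{NC},\Omega}(X)$. For $\omega\in\Omega$, $D_\omega$ is the linear operator on $\mathbf{k}_{\mathrm{NC},\Omega}\{X\}$ extending, by the Leibniz rule, $D_\omega\big((\partial_{\omega_1}\cdots\partial_{\omega_k})(x)\big)=(\partial_\omega\partial_{\omega_1}\cdots\partial_{\omega_k})(x)$. *)

theory Defs
  imports "HOL-Algebra.Module" "HOL-Library.Multiset"
begin

section \<open>Noncommuting multi-differential commutative algebras\<close>

definition derivation ::
  "('k, 'r) ring_scheme \<Rightarrow> ('k, 'a, 'm) module_scheme \<Rightarrow> ('a \<Rightarrow> 'a) \<Rightarrow> bool" where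
  "derivation K A d \<longleftrightarrow>
     d \<in> carrier A \<rightarrow> carrier A \<and>
     (\<forall>x\<in>carrier A. \<forall>y\<in>carrier A. d (x \<oplus>\<^bsub>A\<^esub> y) = d x \<oplus>\<^bsub>A\<^esub> d y) \<and>
     (\<forall>c\<in>carrier K. \<forall>x\<in>carrier A. d (c \<odot>\<^bsub>A\<^esub> x) = c \<odot>\<^bsub>A\<^esub> d x) \<and>
     (\<forall>x\<in>carrier A. \<forall>y\<in>carrier A.
        d (x \<otimes>\<^bsub>A\<^esub> y) = d x \<otimes>\<^bsub>A\<^esub> y \<oplus>\<^bsub>A\<^esub> x \<otimes>\<^bsub>A\<^esub> d y)"

text \<open>
  The library locale \<^locale>\<open>algebra\<close> is the class of commutative, associative, unital algebras
  (the zero algebra included). Nothing relates \<open>\<delta> \<omega>\<close> and \<open>\<delta> \<omega>'\<close> for different indices.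
\<close>

definition nc_multi_diff_algebra ::
  "('k, 'r) ring_scheme \<Rightarrow> 'w set \<Rightarrow> ('k, 'a, 'm) module_scheme \<Rightarrow> ('w \<Rightarrow> 'a \<Rightarrow> 'a) \<Rightarrow> bool" where
  "nc_multi_diff_algebra K \<Omega> A \<delta> \<longleftrightarrow> algebra K A \<and> (\<forall>\<omega>\<in>\<Omega>. derivation K A (\<delta> \<omega>))"

text \<open>
  Homomorphisms are taken extensional, so that equality of functions is equality on the carrier.
\<close>

definition nc_multi_diff_hom ::
  "('k, 'r) ring_scheme \<Rightarrow> 'w set \<Rightarrow>
   ('k, 'a, 'm) module_scheme \<Rightarrow> ('w \<Rightarrow> 'a \<Rightarrow> 'a) \<Rightarrow>
   ('k, 'b, 'n) module_scheme \<Rightarrow> ('w \<Rightarrow> 'b \<Rightarrow> 'b) \<Rightarrow> ('a \<Rightarrow> 'b) set" where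
  "nc_multi_diff_hom K \<Omega> R d S \<delta> =
     {h \<in> ring_hom R S. h \<in> extensional (carrier R) \<and>
        (\<forall>c\<in>carrier K. \<forall>x\<in>carrier R. h (c \<odot>\<^bsub>R\<^esub> x) = c \<odot>\<^bsub>S\<^esub> h x) \<and>
        (\<forall>\<omega>\<in>\<Omega>. \<forall>x\<in>carrier R. h (d \<omega> x) = \<delta> \<omega> (h x))}"


section \<open>Commutative polynomial algebras on a set of variables\<close>

text \<open>
  The free commutative monoid on \<open>V\<close> consists of the finite multisets over \<open>V\<close>; a polynomial is a
  finitely supported coefficient function on it.
\<close>

definition poly_algebra ::
  "('k, 'r) ring_scheme \<Rightarrow> 'v set \<Rightarrow> ('k, 'v multiset \<Rightarrow> 'k) module" where
  "poly_algebra K V =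
     \<lparr>carrier = {p. (\<forall>m. p m \<in> carrier K) \<and> finite {m. p m \<noteq> \<zero>\<^bsub>K\<^esub>} \<and>
                    (\<forall>m. p m \<noteq> \<zero>\<^bsub>K\<^esub> \<longrightarrow> set_mset m \<subseteq> V)},
      monoid.mult = (\<lambda>p q m. \<Oplus>\<^bsub>K\<^esub>ab\<in>{(a, b). a + b = m}. p (fst ab) \<otimes>\<^bsub>K\<^esub> q (snd ab)),
      one = (\<lambda>m. if m = {#} then \<one>\<^bsub>K\<^esub> else \<zero>\<^bsub>K\<^esub>),
      zero = (\<lambda>m. \<zero>\<^bsub>K\<^esub>),
      add = (\<lambda>p q m. p m \<oplus>\<^bsub>K\<^esub> q m),
      smult = (\<lambda>c p m. c \<otimes>\<^bsub>K\<^esub> p m)\<rparr>"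

definition monomial :: "('k, 'r) ring_scheme \<Rightarrow> 'v multiset \<Rightarrow> 'v multiset \<Rightarrow> 'k" where
  "monomial K m = (\<lambda>m'. if m' = m then \<one>\<^bsub>K\<^esub> else \<zero>\<^bsub>K\<^esub>)"

definition variable :: "('k, 'r) ring_scheme \<Rightarrow> 'v \<Rightarrow> 'v multiset \<Rightarrow> 'k" where
  "variable K v = monomial K {#v#}"


section \<open>The differential polynomial algebra\<close>

text \<open>
  The word \<open>\<partial>\<^sub>\<omega>\<^sub>1 \<dots> \<partial>\<^sub>\<omega>\<^sub>k\<close> is the list \<open>[\<omega>\<^sub>1, \<dots>, \<omega>\<^sub>k]\<close>, and the unit is the empty list.
\<close>

definition nc_Delta :: "'w set \<Rightarrow> 'x set \<Rightarrow> ('w list \<times> 'x) set" where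
  "nc_Delta \<Omega> X = lists \<Omega> \<times> X"

definition nc_diff_poly ::
  "('k, 'r) ring_scheme \<Rightarrow> 'w set \<Rightarrow> 'x set \<Rightarrow> ('k, ('w list \<times> 'x) multiset \<Rightarrow> 'k) module" where
  "nc_diff_poly K \<Omega> X = poly_algebra K (nc_Delta \<Omega> X)"

definition nc_prolong :: "'w \<Rightarrow> 'w list \<times> 'x \<Rightarrow> 'w list \<times> 'x" where
  "nc_prolong \<omega> v = (\<omega> # fst v, snd v)"

text \<open>
  Leibniz rule on a monomial: \<open>D\<^sub>\<omega> (u\<^sub>1 \<dots> u\<^sub>n)\<close> is the sum over \<open>i\<close> of the monomials obtained
  by replacing the factor \<open>u\<^sub>i\<close> with \<open>D\<^sub>\<omega> u\<^sub>i\<close>. Equal factors are collected, so that each variable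
  \<open>v\<close> contributes with its multiplicity.
\<close>

definition nc_D_monomial ::
  "('k, 'r) ring_scheme \<Rightarrow> 'w set \<Rightarrow> 'x set \<Rightarrow> 'w \<Rightarrow> ('w list \<times> 'x) multiset \<Rightarrow>
   ('w list \<times> 'x) multiset \<Rightarrow> 'k" where
  "nc_D_monomial K \<Omega> X \<omega> m =
     (\<Oplus>\<^bsub>nc_diff_poly K \<Omega> X\<^esub>v\<in>set_mset m.
        [count m v] \<cdot>\<^bsub>nc_diff_poly K \<Omega> X\<^esub> monomial K (add_mset (nc_prolong \<omega> v) (m - {#v#})))"

definition nc_D ::
  "('k, 'r) ring_scheme \<Rightarrow> 'w set \<Rightarrow> 'x set \<Rightarrow> 'w \<Rightarrow>
   (('w list \<times> 'x) multiset \<Rightarrow> 'k) \<Rightarrow> ('w list \<times> 'x) multiset \<Rightarrow> 'k" where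
  "nc_D K \<Omega> X \<omega> p =
     (\<Oplus>\<^bsub>nc_diff_poly K \<Omega> X\<^esub>m\<in>{m. p m \<noteq> \<zero>\<^bsub>K\<^esub>}.
        p m \<odot>\<^bsub>nc_diff_poly K \<Omega> X\<^esub> nc_D_monomial K \<Omega> X \<omega> m)"

definition nc_incl :: "('k, 'r) ring_scheme \<Rightarrow> 'x \<Rightarrow> ('w list \<times> 'x) multiset \<Rightarrow> 'k" where
  "nc_incl K x = variable K ([], x)"

lemma abelian_monoid_poly_algebra:
  assumes "cring K"
  shows "abelian_monoid (poly_algebra K V)"
proof -
  interpret K: cring K by fact
  show ?thesis
  proof (rule abelian_monoidI)
    fix p q
    assume p: "p \<in> carrier (poly_algebra K V)" and q: "q \<in> carrier (poly_algebra K V)"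
    have "{m. p m \<oplus>\<^bsub>K\<^esub> q m \<noteq> \<zero>\<^bsub>K\<^esub>} \<subseteq> {m. p m \<noteq> \<zero>\<^bsub>K\<^esub>} \<union> {m. q m \<noteq> \<zero>\<^bsub>K\<^esub>}"
      by auto
    moreover have "finite ({m. p m \<noteq> \<zero>\<^bsub>K\<^esub>} \<union> {m. q m \<noteq> \<zero>\<^bsub>K\<^esub>})"
      using p q by (simp add: poly_algebra_def)
    ultimately have "finite {m. p m \<oplus>\<^bsub>K\<^esub> q m \<noteq> \<zero>\<^bsub>K\<^esub>}"
      by (rule finite_subset)
    moreover have "set_mset m \<subseteq> V" if "p m \<oplus>\<^bsub>K\<^esub> q m \<noteq> \<zero>\<^bsub>K\<^esub>" for m
    proof -
      have "p m \<noteq> \<zero>\<^bsub>K\<^esub> \<or> q m \<noteq> \<zero>\<^bsub>K\<^esub>"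
        using that by auto
      then show ?thesis
        using p q unfolding poly_algebra_def by auto
    qed
    ultimately show "p \<oplus>\<^bsub>poly_algebra K V\<^esub> q \<in> carrier (poly_algebra K V)"
      using p q by (simp add: poly_algebra_def)
  qed (auto simp: poly_algebra_def K.a_ac)
qed

lemma nc_D_variable:
  assumes K: "field K" and \<omega>: "\<omega> \<in> \<Omega>" and v: "(w, x) \<in> nc_Delta \<Omega> X"
  shows "nc_D K \<Omega> X \<omega> (variable K (w, x)) = variable K (\<omega> # w, x)"
proof -
  interpret K: field K by fact
  let ?P = "nc_diff_poly K \<Omega> X"
  interpret P: abelian_monoid ?P
    unfolding nc_diff_poly_def by (rule abelian_monoid_poly_algebra) (rule K.cring_axioms)
  have v': "(\<omega> # w, x) \<in> nc_Delta \<Omega> X"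
    using v \<omega> by (simp add: nc_Delta_def)
  have supp: "{m. variable K (w, x) m \<noteq> \<zero>\<^bsub>K\<^esub>} = {{#(w, x)#}}"
    by (auto simp: variable_def monomial_def)
  have var: "variable K (\<omega> # w, x) \<in> carrier ?P"
    using v' unfolding nc_diff_poly_def poly_algebra_def
    by (auto simp: variable_def monomial_def)
  have mon: "nc_D_monomial K \<Omega> X \<omega> {#(w, x)#} = variable K (\<omega> # w, x)"
    using var by (simp add: nc_D_monomial_def nc_prolong_def variable_def add_pow_def)
  have one: "variable K (w, x) {#(w, x)#} = \<one>\<^bsub>K\<^esub>"
    by (simp add: variable_def monomial_def)
  have "\<one>\<^bsub>K\<^esub> \<odot>\<^bsub>?P\<^esub> variable K (\<omega> # w, x) = variable K (\<omega> # w, x)"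
    by (auto simp: nc_diff_poly_def poly_algebra_def variable_def monomial_def)
  then show ?thesis
    using var by (simp add: nc_D_def supp mon one)
qed

end

theory Submission
  imports Defs
begin

text \<open>
  Everything is checked on monomials. A polynomial is a linear combination of monomials, so linear
  and bilinear identities (associativity of the product, the Leibniz rule, multiplicativity and
  differential compatibility of the evaluation map) reduce to them, and there an induction on the
  number of factors applies: \<open>D\<^sub>\<omega> (v m) = (\<partial>\<^sub>\<omega> v) m + v D\<^sub>\<omega> m\<close>. A homomorphism
  extending \<open>f\<close> has to send the variable \<open>(\<partial>\<^sub>\<omega>\<^sub>1 \<dots> \<partial>\<^sub>\<omega>\<^sub>k)(x)\<close> to
  \<open>\<delta>\<^sub>\<omega>\<^sub>1 (\<dots> (\<delta>\<^sub>\<omega>\<^sub>k (f x)))\<close>. This determines it, and conversely the algebra homomorphism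
  with these values on variables commutes with the derivations. As the words are free, no relation
  between the \<open>\<delta>\<^sub>\<omega>\<close> is required.
\<close>

section \<open>The polynomial algebra\<close>

text \<open>A \<open>finsum\<close> over an infinite set is zero by convention, so the convolution
  product is meaningful only because this index set is finite. In a splitting of
  \<open>add_mset x m\<close> a copy of \<open>x\<close> lies in one of the two summands, and
  removing it leaves a splitting of \<open>m\<close>.\<close>

lemma finite_mset_splittings: "finite {(a, b). a + b = (m :: 'v multiset)}"
proof (induction m)
  case empty
  then show ?case
    by (simp add: case_prod_unfold finite_subset[of _ "{({#}, {#})}"] subset_iff prod_eq_iff)
next
  case (add x m)
  let ?S = "{(a, b). a + b = m}"
  have "{(a, b). a + b = add_mset x m} \<subseteq>
      (\<lambda>(a, b). (add_mset x a, b)) ` ?S \<union> (\<lambda>(a, b). (a, add_mset x b)) ` ?S"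
  proof clarify
    fix a b :: "'v multiset"
    assume ab: "a + b = add_mset x m"
      and "(a, b) \<notin> (\<lambda>(a, b). (a, add_mset x b)) ` ?S"
    then have "x \<notin># b"
      by (force dest!: multi_member_split)
    with ab have "x \<in># a"
      by (metis union_iff union_single_eq_member)
    with ab show "(a, b) \<in> (\<lambda>(a, b). (add_mset x a, b)) ` ?S"
      by (force dest!: multi_member_split)
  qed
  with add.IH show ?case
    by (simp add: finite_subset)
qed

locale polynomial_algebra = K?: cring K for K (structure) +
  fixes V :: "'v set"
begin

abbreviation P where "P \<equiv> poly_algebra K V"

section \<open>Coefficients, module structure and induction over scaled monomials\<close>

lemma poly_carrier_iff:
  "p \<in> carrier P \<longleftrightarrow> (\<forall>m. p m \<in> carrier K) \<and> finite {m. p m \<noteq> \<zero>} \<and>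
     (\<forall>m. p m \<noteq> \<zero> \<longrightarrow> set_mset m \<subseteq> V)"
  by (simp add: poly_algebra_def)

lemma poly_coeff_closed: "p \<in> carrier P \<Longrightarrow> p m \<in> carrier K"
  by (simp add: poly_carrier_iff)

lemma poly_supportD: "p \<in> carrier P \<Longrightarrow> p m \<noteq> \<zero> \<Longrightarrow> set_mset m \<subseteq> V"
  by (simp add: poly_carrier_iff)

lemma poly_finite_support: "p \<in> carrier P \<Longrightarrow> finite {m. p m \<noteq> \<zero>}"
  by (simp add: poly_carrier_iff)

lemma poly_coeff_simps:
  "(p \<oplus>\<^bsub>P\<^esub> q) m = p m \<oplus> q m" "\<zero>\<^bsub>P\<^esub> m = \<zero>" "(c \<odot>\<^bsub>P\<^esub> p) m = c \<otimes> p m"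
  "(p \<otimes>\<^bsub>P\<^esub> q) m = (\<Oplus>ab\<in>{(a, b). a + b = m}. p (fst ab) \<otimes> q (snd ab))"
  by (simp_all add: poly_algebra_def)

lemma one_eq_monomial: "\<one>\<^bsub>P\<^esub> = monomial K {#}"
  by (simp add: poly_algebra_def monomial_def)

lemma monomial_closed [simp]: "set_mset m \<subseteq> V \<Longrightarrow> monomial K m \<in> carrier P"
  by (auto simp: poly_carrier_iff monomial_def)

lemma poly_smult_closed:
  assumes "c \<in> carrier K" "p \<in> carrier P"
  shows "c \<odot>\<^bsub>P\<^esub> p \<in> carrier P"
proof -
  note coeff [simp] = poly_coeff_closed[OF assms(2)]
  have "{m. c \<otimes> p m \<noteq> \<zero>} \<subseteq> {m. p m \<noteq> \<zero>}"
    using assms by auto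
  moreover have "set_mset m \<subseteq> V" if "c \<otimes> p m \<noteq> \<zero>" for m
    using that assms poly_supportD[OF assms(2), of m] by force
  ultimately show ?thesis
    using assms(1) finite_subset[OF _ poly_finite_support[OF assms(2)]]
    by (auto simp: poly_carrier_iff poly_coeff_simps)
qed

lemma abelian_group_poly_algebra: "abelian_group P"
proof -
  interpret P: abelian_monoid P
    by (rule abelian_monoid_poly_algebra) (rule K.is_cring)
  have "\<exists>q\<in>carrier P. q \<oplus>\<^bsub>P\<^esub> p = \<zero>\<^bsub>P\<^esub>" if "p \<in> carrier P" for p
  proof
    \<comment> \<open>The additive inverse is taken as a scalar multiple, so its membership in the
      carrier is already known.\<close>
    show "(\<ominus> \<one>) \<odot>\<^bsub>P\<^esub> p \<in> carrier P"
      using that by (simp add: poly_smult_closed)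
    show "(\<ominus> \<one>) \<odot>\<^bsub>P\<^esub> p \<oplus>\<^bsub>P\<^esub> p = \<zero>\<^bsub>P\<^esub>"
      using poly_coeff_closed[OF that] by (simp add: fun_eq_iff poly_coeff_simps K.l_minus K.l_neg)
  qed
  then show ?thesis
    by (intro abelian_groupI) (auto simp: P.a_ac)
qed

lemma module_poly_algebra: "module K P"
proof (rule moduleI)
  show "a \<odot>\<^bsub>P\<^esub> p \<in> carrier P" if "a \<in> carrier K" "p \<in> carrier P" for a p
    using that by (rule poly_smult_closed)
qed (simp_all add: K.is_cring abelian_group_poly_algebra fun_eq_iff poly_coeff_simps
    K.l_distr K.r_distr K.m_assoc poly_coeff_closed)

sublocale P: module K P
  by (rule module_poly_algebra)

text \<open>Finite support makes every polynomial a finite sum of scaled monomials. All later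
  linearity arguments go through this rule.\<close>

lemma poly_induct [consumes 1, case_names zero add monomial]:
  assumes "p \<in> carrier P"
    and "Q \<zero>\<^bsub>P\<^esub>"
    and add: "\<And>p q. p \<in> carrier P \<Longrightarrow> q \<in> carrier P \<Longrightarrow> Q p \<Longrightarrow> Q q \<Longrightarrow> Q (p \<oplus>\<^bsub>P\<^esub> q)"
    and mon: "\<And>c m. c \<in> carrier K \<Longrightarrow> set_mset m \<subseteq> V \<Longrightarrow> Q (c \<odot>\<^bsub>P\<^esub> monomial K m)"
  shows "Q p"
proof -
  \<comment> \<open>The induction is on a finite set containing the support rather than on the
    support itself. A listed monomial may then have coefficient zero, and only an inclusion has to
    be maintained.\<close>
  have "finite S \<Longrightarrow> p \<in> carrier P \<Longrightarrow> {m. p m \<noteq> \<zero>} \<subseteq> S \<Longrightarrow> Q p" for S p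
  proof (induction S arbitrary: p rule: finite_induct)
    case empty
    then have "p = \<zero>\<^bsub>P\<^esub>"
      by (auto simp: poly_coeff_simps)
    then show ?case
      using assms(2) by simp
  next
    case (insert m S)
    show ?case
    proof (cases "p m = \<zero>")
      case True
      then show ?thesis
        using insert by (intro insert.IH) auto
    next
      case False
      \<comment> \<open>Erasing the coefficient at \<open>m\<close> leaves a polynomial supported in
        \<open>S\<close>, and \<open>p\<close> is recovered by adding one scaled monomial.\<close>
      define q where "q = p(m := \<zero>)"
      have sub: "{a. q a \<noteq> \<zero>} \<subseteq> {a. p a \<noteq> \<zero>}"
        by (auto simp: q_def)
      have "q \<in> carrier P"
        using insert.prems(1) finite_subset[OF sub]
        by (auto simp: poly_carrier_iff q_def split: if_splits)
      moreover have "Q q"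
      proof (rule insert.IH)
        show "{a. q a \<noteq> \<zero>} \<subseteq> S"
          using insert.prems(2) by (auto simp: q_def)
      qed fact
      moreover have "set_mset m \<subseteq> V"
        using False insert.prems(1) by (rule poly_supportD[rotated])
      moreover have "q \<oplus>\<^bsub>P\<^esub> (p m \<odot>\<^bsub>P\<^esub> monomial K m) = p"
        using poly_coeff_closed[OF insert.prems(1)]
        by (auto simp: poly_coeff_simps q_def monomial_def)
      ultimately show ?thesis
        using add[of q "p m \<odot>\<^bsub>P\<^esub> monomial K m"] mon[of "p m" m]
          poly_coeff_closed[OF insert.prems(1)]
        by simp
    qed
  qed
  then show ?thesis
    using assms(1) poly_finite_support by blast
qed

section \<open>The convolution product and the algebra laws\<close>

lemma poly_mult_closed:
  assumes p: "p \<in> carrier P" and q: "q \<in> carrier P"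
  shows "p \<otimes>\<^bsub>P\<^esub> q \<in> carrier P"
proof -
  note coeff [simp] = poly_coeff_closed[OF p] poly_coeff_closed[OF q]
  \<comment> \<open>A nonzero coefficient of the product comes from a pair of monomials in the two
    supports. This gives both the finiteness of the support and the restriction to variables in
    \<open>V\<close>.\<close>
  have ex: "\<exists>a b. a + b = m \<and> p a \<noteq> \<zero> \<and> q b \<noteq> \<zero>" if "(p \<otimes>\<^bsub>P\<^esub> q) m \<noteq> \<zero>" for m
  proof (rule ccontr)
    assume "\<not> ?thesis"
    then have "p (fst ab) \<otimes> q (snd ab) = \<zero>" if "ab \<in> {(a, b). a + b = m}" for ab
      using that p q by (cases ab) force
    then have "(p \<otimes>\<^bsub>P\<^esub> q) m = \<zero>"
      unfolding poly_coeff_simps by (intro K.add.finprod_one_eqI)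
    then show False
      using that by simp
  qed
  have "{m. (p \<otimes>\<^bsub>P\<^esub> q) m \<noteq> \<zero>} \<subseteq> (\<lambda>(a, b). a + b) ` ({a. p a \<noteq> \<zero>} \<times> {b. q b \<noteq> \<zero>})"
    using ex by (fastforce simp: image_iff)
  then have "finite {m. (p \<otimes>\<^bsub>P\<^esub> q) m \<noteq> \<zero>}"
    by (rule finite_subset) (use p q in \<open>simp add: poly_finite_support\<close>)
  moreover have "set_mset m \<subseteq> V" if "(p \<otimes>\<^bsub>P\<^esub> q) m \<noteq> \<zero>" for m
    using ex[OF that] poly_supportD[OF p] poly_supportD[OF q] by fastforce
  moreover have "(p \<otimes>\<^bsub>P\<^esub> q) m \<in> carrier K" for m
    unfolding poly_coeff_simps using p q by (intro K.finsum_closed) auto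
  ultimately show ?thesis
    unfolding poly_carrier_iff by blast
qed

text \<open>Swapping the two components permutes the splittings of \<open>m\<close>, which reindexes
  the convolution sum.\<close>

lemma poly_mult_comm:
  assumes p: "p \<in> carrier P" and q: "q \<in> carrier P"
  shows "p \<otimes>\<^bsub>P\<^esub> q = q \<otimes>\<^bsub>P\<^esub> p"
proof
  note coeff [simp] = poly_coeff_closed[OF p] poly_coeff_closed[OF q]
  fix m :: "'v multiset"
  let ?S = "{(a, b). a + b = m}"
  have "bij_betw prod.swap ?S ?S"
    by (rule bij_betwI[where g = prod.swap]) (auto simp: add.commute)
  then have im: "prod.swap ` ?S = ?S" and inj: "inj_on prod.swap ?S"
    by (auto simp: bij_betw_def)
  have "(p \<otimes>\<^bsub>P\<^esub> q) m = (\<Oplus>ab\<in>prod.swap ` ?S. p (fst ab) \<otimes> q (snd ab))"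
    by (simp only: im poly_coeff_simps)
  also have "\<dots> = (\<Oplus>ab\<in>?S. p (fst (prod.swap ab)) \<otimes> q (snd (prod.swap ab)))"
    using p q inj by (intro K.finsum_reindex) auto
  also have "\<dots> = (q \<otimes>\<^bsub>P\<^esub> p) m"
    unfolding poly_coeff_simps using p q by (intro K.finsum_cong') (auto simp: K.m_comm)
  finally show "(p \<otimes>\<^bsub>P\<^esub> q) m = (q \<otimes>\<^bsub>P\<^esub> p) m" .
qed

lemma poly_mult_l_distr:
  assumes "p \<in> carrier P" "q \<in> carrier P" "r \<in> carrier P"
  shows "(p \<oplus>\<^bsub>P\<^esub> q) \<otimes>\<^bsub>P\<^esub> r = p \<otimes>\<^bsub>P\<^esub> r \<oplus>\<^bsub>P\<^esub> q \<otimes>\<^bsub>P\<^esub> r"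
proof
  note coeff [simp] = poly_coeff_closed[OF assms(1)] poly_coeff_closed[OF assms(2)] poly_coeff_closed[OF assms(3)]
  fix m :: "'v multiset"
  have "((p \<oplus>\<^bsub>P\<^esub> q) \<otimes>\<^bsub>P\<^esub> r) m =
      (\<Oplus>ab\<in>{(a, b). a + b = m}. p (fst ab) \<otimes> r (snd ab) \<oplus> q (fst ab) \<otimes> r (snd ab))"
    unfolding poly_coeff_simps using assms by (intro K.finsum_cong') (auto simp: K.l_distr)
  also have "\<dots> = (p \<otimes>\<^bsub>P\<^esub> r \<oplus>\<^bsub>P\<^esub> q \<otimes>\<^bsub>P\<^esub> r) m"
    unfolding poly_coeff_simps using assms by (intro K.finsum_addf) auto
  finally show "((p \<oplus>\<^bsub>P\<^esub> q) \<otimes>\<^bsub>P\<^esub> r) m = (p \<otimes>\<^bsub>P\<^esub> r \<oplus>\<^bsub>P\<^esub> q \<otimes>\<^bsub>P\<^esub> r) m" .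
qed

lemma poly_smult_mult:
  assumes "c \<in> carrier K" "p \<in> carrier P" "q \<in> carrier P"
  shows "(c \<odot>\<^bsub>P\<^esub> p) \<otimes>\<^bsub>P\<^esub> q = c \<odot>\<^bsub>P\<^esub> (p \<otimes>\<^bsub>P\<^esub> q)"
proof
  note coeff [simp] = poly_coeff_closed[OF assms(2)] poly_coeff_closed[OF assms(3)]
  fix m :: "'v multiset"
  have "((c \<odot>\<^bsub>P\<^esub> p) \<otimes>\<^bsub>P\<^esub> q) m =
      (\<Oplus>ab\<in>{(a, b). a + b = m}. c \<otimes> (p (fst ab) \<otimes> q (snd ab)))"
    unfolding poly_coeff_simps using assms by (intro K.finsum_cong') (auto simp: K.m_assoc)
  also have "\<dots> = (c \<odot>\<^bsub>P\<^esub> (p \<otimes>\<^bsub>P\<^esub> q)) m"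
    unfolding poly_coeff_simps using assms finite_mset_splittings
    by (intro K.finsum_rdistr[symmetric]) auto
  finally show "((c \<odot>\<^bsub>P\<^esub> p) \<otimes>\<^bsub>P\<^esub> q) m = (c \<odot>\<^bsub>P\<^esub> (p \<otimes>\<^bsub>P\<^esub> q)) m" .
qed

lemma poly_mult_r_distr:
  assumes "p \<in> carrier P" "q \<in> carrier P" "r \<in> carrier P"
  shows "r \<otimes>\<^bsub>P\<^esub> (p \<oplus>\<^bsub>P\<^esub> q) = r \<otimes>\<^bsub>P\<^esub> p \<oplus>\<^bsub>P\<^esub> r \<otimes>\<^bsub>P\<^esub> q"
  using assms
  by (simp add: poly_mult_comm[of r p] poly_mult_comm[of r q]
      poly_mult_comm[of r "p \<oplus>\<^bsub>P\<^esub> q"] poly_mult_l_distr)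

lemma poly_mult_smult:
  assumes "c \<in> carrier K" "p \<in> carrier P" "q \<in> carrier P"
  shows "p \<otimes>\<^bsub>P\<^esub> (c \<odot>\<^bsub>P\<^esub> q) = c \<odot>\<^bsub>P\<^esub> (p \<otimes>\<^bsub>P\<^esub> q)"
  using assms by (simp add: poly_mult_comm[of p q] poly_mult_comm[of p "c \<odot>\<^bsub>P\<^esub> q"]
      poly_smult_mult)

text \<open>The only pair that can contribute is \<open>(a, b)\<close>, and it occurs among the
  splittings of \<open>m\<close> exactly when \<open>a + b = m\<close>.\<close>

lemma monomial_mult:
  "monomial K a \<otimes>\<^bsub>P\<^esub> monomial K b = monomial K (a + b)"
proof
  fix m :: "'v multiset"
  let ?S = "{(x, y). x + y = m}"
  have eq: "(monomial K a \<otimes>\<^bsub>P\<^esub> monomial K b) m =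
      (\<Oplus>xy\<in>?S. if (a, b) = xy then \<one> else \<zero>)"
    unfolding poly_coeff_simps by (intro K.finsum_cong') (auto simp: monomial_def)
  show "(monomial K a \<otimes>\<^bsub>P\<^esub> monomial K b) m = monomial K (a + b) m"
  proof (cases "a + b = m")
    case True
    then have "(\<Oplus>xy\<in>?S. if (a, b) = xy then \<one> else \<zero>) = \<one>"
      by (intro K.finsum_singleton finite_mset_splittings) auto
    then show ?thesis
      using True eq by (simp add: monomial_def)
  next
    case False
    then have "(\<Oplus>xy\<in>?S. if (a, b) = xy then \<one> else \<zero>) = \<zero>"
      by (intro K.add.finprod_one_eqI) auto
    then show ?thesis
      using False eq by (simp add: monomial_def)
  qed
qed

text \<open>The ring laws are not yet established at this point. Writing the zero polynomial as the
  scalar \<open>\<zero>\<close> times itself and pulling that scalar out of the product gives the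
  claim.\<close>

lemma poly_zero_mult:
  assumes "p \<in> carrier P"
  shows "\<zero>\<^bsub>P\<^esub> \<otimes>\<^bsub>P\<^esub> p = \<zero>\<^bsub>P\<^esub>"
  using poly_smult_mult[of \<zero> "\<zero>\<^bsub>P\<^esub>" p] assms by (simp add: poly_mult_closed)

lemma poly_mult_zero:
  assumes "p \<in> carrier P"
  shows "p \<otimes>\<^bsub>P\<^esub> \<zero>\<^bsub>P\<^esub> = \<zero>\<^bsub>P\<^esub>"
  using assms by (simp add: poly_mult_comm[of p "\<zero>\<^bsub>P\<^esub>"] poly_zero_mult)

lemma poly_one_mult:
  assumes "p \<in> carrier P"
  shows "\<one>\<^bsub>P\<^esub> \<otimes>\<^bsub>P\<^esub> p = p"
  using assms unfolding one_eq_monomial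
  by (induction rule: poly_induct)
    (simp_all add: poly_mult_zero poly_mult_r_distr poly_mult_smult monomial_mult)

lemmas poly_mult_simps =
  poly_zero_mult poly_mult_zero poly_mult_l_distr poly_mult_r_distr
  poly_smult_mult poly_mult_smult monomial_mult

text \<open>Both sides are linear in each argument, so a reindexing of double convolution sums is
  avoided: the arguments are reduced to monomials one at a time, first \<open>r\<close>, then
  \<open>q\<close>, then \<open>p\<close>. On monomials the law is associativity of multiset
  union.\<close>

lemma poly_mult_assoc:
  assumes "p \<in> carrier P" "q \<in> carrier P" "r \<in> carrier P"
  shows "(p \<otimes>\<^bsub>P\<^esub> q) \<otimes>\<^bsub>P\<^esub> r = p \<otimes>\<^bsub>P\<^esub> (q \<otimes>\<^bsub>P\<^esub> r)"
proof -
  note simps = poly_mult_simps poly_mult_closed P.smult_assoc1 add.assoc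
  have 1: "(monomial K a \<otimes>\<^bsub>P\<^esub> monomial K b) \<otimes>\<^bsub>P\<^esub> r =
      monomial K a \<otimes>\<^bsub>P\<^esub> (monomial K b \<otimes>\<^bsub>P\<^esub> r)"
    if "set_mset a \<subseteq> V" "set_mset b \<subseteq> V" for a b
    using assms(3) that by (induction rule: poly_induct) (simp_all add: simps)
  have 2: "(monomial K a \<otimes>\<^bsub>P\<^esub> q) \<otimes>\<^bsub>P\<^esub> r = monomial K a \<otimes>\<^bsub>P\<^esub> (q \<otimes>\<^bsub>P\<^esub> r)"
    if "set_mset a \<subseteq> V" for a
    \<comment> \<open>Fact \<open>1\<close> has a product of two monomials on its left-hand side.
      With \<open>monomial_mult\<close> active that product would be merged before \<open>1\<close>
      could apply.\<close>
    using assms(2) assms(3) that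
    by (induction rule: poly_induct) (simp_all add: simps 1 del: monomial_mult)
  show ?thesis
    using assms(1) assms(2,3) by (induction rule: poly_induct) (simp_all add: simps 2)
qed

lemma algebra_poly_algebra: "algebra K P"
proof -
  have "cring P"
    by (intro cringI abelian_group_poly_algebra comm_monoidI poly_mult_closed poly_mult_assoc
        poly_one_mult poly_mult_comm poly_mult_l_distr)
      (simp_all add: one_eq_monomial)
  then show ?thesis
    by (intro algebraI K.is_cring)
      (simp_all add: P.smult_l_distr P.smult_r_distr P.smult_assoc1 poly_smult_mult)
qed

sublocale P: algebra K P
  by (rule algebra_poly_algebra)

end

section \<open>Linear extension from monomials\<close>

text \<open>Both the operators \<open>nc_D\<close> and the evaluation homomorphism are instances,
  with the polynomial algebra itself and the target algebra as \<open>M\<close>. Linearity is thus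
  proved once for both.\<close>

definition linear_extension ::
  "('k, 'r) ring_scheme \<Rightarrow> ('k, 'a, 'm) module_scheme \<Rightarrow> ('v multiset \<Rightarrow> 'a) \<Rightarrow>
   ('v multiset \<Rightarrow> 'k) \<Rightarrow> 'a" where
  "linear_extension K M g p = (\<Oplus>\<^bsub>M\<^esub>m\<in>{m. p m \<noteq> \<zero>\<^bsub>K\<^esub>}. p m \<odot>\<^bsub>M\<^esub> g m)"

locale monomial_extension = polynomial_algebra K V + M?: module K M
  for K (structure) and V :: "'v set" and M (structure) +
  fixes g :: "'v multiset \<Rightarrow> 'c"
  assumes g_closed: "set_mset m \<subseteq> V \<Longrightarrow> g m \<in> carrier M"
begin

abbreviation L where "L \<equiv> linear_extension K M g"

text \<open>Different polynomials have different supports, so their sums become comparable only over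
  a common finite index set, on which the extra terms vanish. The members of \<open>S\<close> must
  be monomials over \<open>V\<close>, since elsewhere nothing is known about
  \<open>g\<close>.\<close>

lemma linear_extension_superset:
  assumes p: "p \<in> carrier P" and S: "finite S" "{m. p m \<noteq> \<zero>\<^bsub>K\<^esub>} \<subseteq> S"
    "\<And>m. m \<in> S \<Longrightarrow> set_mset m \<subseteq> V"
  shows "L p = (\<Oplus>\<^bsub>M\<^esub>m\<in>S. p m \<odot>\<^bsub>M\<^esub> g m)"
  unfolding linear_extension_def
proof (rule M.add.finprod_mono_neutral_cong_left[OF S(1,2)])
  show "(\<lambda>m. p m \<odot>\<^bsub>M\<^esub> g m) \<in> S \<rightarrow> carrier M"
    using S(3) g_closed poly_coeff_closed[OF p] by auto
  show "p m \<odot>\<^bsub>M\<^esub> g m = \<zero>\<^bsub>M\<^esub>" if "m \<in> S - {m. p m \<noteq> \<zero>\<^bsub>K\<^esub>}" for m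
    using that S(3) g_closed by auto
qed simp

lemma linear_extension_closed:
  assumes p: "p \<in> carrier P"
  shows "L p \<in> carrier M"
  unfolding linear_extension_def
  using poly_coeff_closed[OF p] poly_supportD[OF p] g_closed by (intro M.finsum_closed) auto

lemma linear_extension_add:
  assumes p: "p \<in> carrier P" and q: "q \<in> carrier P"
  shows "L (p \<oplus>\<^bsub>P\<^esub> q) = L p \<oplus>\<^bsub>M\<^esub> L q"
proof -
  let ?S = "{m. p m \<noteq> \<zero>\<^bsub>K\<^esub>} \<union> {m. q m \<noteq> \<zero>\<^bsub>K\<^esub>}"
  have fin: "finite ?S"
    using p q by (simp add: poly_finite_support)
  have V: "set_mset m \<subseteq> V" if "m \<in> ?S" for m
    using that poly_supportD[OF p, of m] poly_supportD[OF q, of m] by blast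
  have "L (p \<oplus>\<^bsub>P\<^esub> q) = (\<Oplus>\<^bsub>M\<^esub>m\<in>?S. (p \<oplus>\<^bsub>P\<^esub> q) m \<odot>\<^bsub>M\<^esub> g m)"
    using p q fin V by (intro linear_extension_superset) (auto simp: poly_coeff_simps)
  also have "\<dots> = (\<Oplus>\<^bsub>M\<^esub>m\<in>?S. p m \<odot>\<^bsub>M\<^esub> g m \<oplus>\<^bsub>M\<^esub> q m \<odot>\<^bsub>M\<^esub> g m)"
    using V g_closed poly_coeff_closed[OF p] poly_coeff_closed[OF q]
    by (intro M.finsum_cong') (auto simp: poly_coeff_simps M.smult_l_distr)
  also have "\<dots> = (\<Oplus>\<^bsub>M\<^esub>m\<in>?S. p m \<odot>\<^bsub>M\<^esub> g m) \<oplus>\<^bsub>M\<^esub> (\<Oplus>\<^bsub>M\<^esub>m\<in>?S. q m \<odot>\<^bsub>M\<^esub> g m)"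
    using V g_closed poly_coeff_closed[OF p] poly_coeff_closed[OF q]
    by (intro M.finsum_addf) auto
  also have "(\<Oplus>\<^bsub>M\<^esub>m\<in>?S. p m \<odot>\<^bsub>M\<^esub> g m) = L p"
    using p fin V by (intro linear_extension_superset[symmetric]) auto
  also have "(\<Oplus>\<^bsub>M\<^esub>m\<in>?S. q m \<odot>\<^bsub>M\<^esub> g m) = L q"
    using q fin V by (intro linear_extension_superset[symmetric]) auto
  finally show ?thesis .
qed

lemma linear_extension_smult:
  assumes c: "c \<in> carrier K" and p: "p \<in> carrier P"
  shows "L (c \<odot>\<^bsub>P\<^esub> p) = c \<odot>\<^bsub>M\<^esub> L p"
proof -
  let ?S = "{m. p m \<noteq> \<zero>\<^bsub>K\<^esub>}"
  have fin: "finite ?S"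
    using p by (rule poly_finite_support)
  have closed: "g m \<in> carrier M" if "m \<in> ?S" for m
    using that poly_supportD[OF p, of m] g_closed by blast
  \<comment> \<open>Scaling can shrink the support, so the sum is kept over the support of
    \<open>p\<close>.\<close>
  have "L (c \<odot>\<^bsub>P\<^esub> p) = (\<Oplus>\<^bsub>M\<^esub>m\<in>?S. (c \<odot>\<^bsub>P\<^esub> p) m \<odot>\<^bsub>M\<^esub> g m)"
    using c p fin poly_supportD[OF p]
    by (intro linear_extension_superset) (auto simp: poly_coeff_simps)
  also have "\<dots> = (\<Oplus>\<^bsub>M\<^esub>m\<in>?S. c \<odot>\<^bsub>M\<^esub> (p m \<odot>\<^bsub>M\<^esub> g m))"
    using c closed poly_coeff_closed[OF p]
    by (intro M.finsum_cong') (auto simp: poly_coeff_simps M.smult_assoc1)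
  also have "\<dots> = c \<odot>\<^bsub>M\<^esub> L p"
    unfolding linear_extension_def using c closed poly_coeff_closed[OF p] fin
    by (intro M.finsum_smult_ldistr[symmetric]) auto
  finally show ?thesis .
qed

lemma linear_extension_monomial:
  assumes m: "set_mset m \<subseteq> V"
  shows "L (monomial K m) = g m"
proof -
  \<comment> \<open>The index set is \<open>{m}\<close> and not the support, which would be empty if
    \<open>\<one> = \<zero>\<close> in \<open>K\<close>.\<close>
  have "L (monomial K m) = (\<Oplus>\<^bsub>M\<^esub>a\<in>{m}. monomial K m a \<odot>\<^bsub>M\<^esub> g a)"
    using m monomial_closed[OF m]
    by (intro linear_extension_superset) (auto simp: monomial_def split: if_splits)
  also have "\<dots> = g m"
    using g_closed[OF m] by (simp add: monomial_def)
  finally show ?thesis .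
qed

lemma linear_extension_zero: "L \<zero>\<^bsub>P\<^esub> = \<zero>\<^bsub>M\<^esub>"
  by (simp add: linear_extension_def poly_coeff_simps)

end

lemma (in comm_monoid) finprod_count_add_mset:
  assumes "\<phi> v \<in> carrier G" and "\<And>u. u \<in># m \<Longrightarrow> \<phi> u \<in> carrier G"
  shows "(\<Otimes>u\<in>set_mset (add_mset v m). \<phi> u [^] count (add_mset v m) u) =
    \<phi> v \<otimes> (\<Otimes>u\<in>set_mset m. \<phi> u [^] count m u)"
proof -
  let ?S = "set_mset (add_mset v m)"
  have closed: "\<phi> u \<in> carrier G" if "u \<in> ?S" for u
    using assms that by auto
  have "(\<Otimes>u\<in>?S. \<phi> u [^] count (add_mset v m) u) =
      (\<Otimes>u\<in>?S. (if v = u then \<phi> u else \<one>) \<otimes> \<phi> u [^] count m u)"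
    using closed by (intro finprod_cong') (auto simp: m_comm)
  also have "\<dots> = (\<Otimes>u\<in>?S. if v = u then \<phi> u else \<one>) \<otimes> (\<Otimes>u\<in>?S. \<phi> u [^] count m u)"
    using closed by (intro finprod_multf) auto
  also have "(\<Otimes>u\<in>?S. if v = u then \<phi> u else \<one>) = \<phi> v"
    using closed by (intro finprod_singleton) auto
  also have "(\<Otimes>u\<in>?S. \<phi> u [^] count m u) = (\<Otimes>u\<in>set_mset m. \<phi> u [^] count m u)"
    using closed by (intro finprod_mono_neutral_cong_right) (auto simp: not_in_iff)
  finally show ?thesis .
qed

section \<open>The derivations\<close>

locale differential_polynomials = polynomial_algebra K "nc_Delta \<Omega> X"
  for K (structure) and \<Omega> :: "'w set" and X :: "'x set"
begin

abbreviation \<Delta> where "\<Delta> \<equiv> nc_Delta \<Omega> X"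

lemma nc_prolong_closed: "\<omega> \<in> \<Omega> \<Longrightarrow> v \<in> \<Delta> \<Longrightarrow> nc_prolong \<omega> v \<in> \<Delta>"
  by (auto simp: nc_Delta_def nc_prolong_def)

lemma prolonged_monomial_closed:
  "\<omega> \<in> \<Omega> \<Longrightarrow> v \<in> \<Delta> \<Longrightarrow> set_mset m \<subseteq> \<Delta> \<Longrightarrow>
    monomial K (add_mset (nc_prolong \<omega> v) (m - {#v#})) \<in> carrier P"
  by (intro monomial_closed) (auto simp: nc_prolong_closed dest: in_diffD)

lemma nc_D_monomial_closed:
  assumes "\<omega> \<in> \<Omega>" and "set_mset m \<subseteq> \<Delta>"
  shows "nc_D_monomial K \<Omega> X \<omega> m \<in> carrier P"
  unfolding nc_D_monomial_def nc_diff_poly_def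
  using assms
  by (intro P.finsum_closed Pi_I P.add.nat_pow_closed prolonged_monomial_closed) auto

lemma nc_D_monomial_empty: "nc_D_monomial K \<Omega> X \<omega> {#} = \<zero>\<^bsub>P\<^esub>"
  by (simp add: nc_D_monomial_def nc_diff_poly_def)

text \<open>This is the Leibniz rule for splitting off one variable, the recursion behind every
  induction on the number of factors. Differentiating the new copy of \<open>v\<close> gives the
  first summand, and every other term merely acquires the factor \<open>v\<close>.\<close>

lemma nc_D_monomial_add_mset:
  assumes \<omega>: "\<omega> \<in> \<Omega>" and v: "v \<in> \<Delta>" and m: "set_mset m \<subseteq> \<Delta>"
  shows "nc_D_monomial K \<Omega> X \<omega> (add_mset v m) =
    monomial K (add_mset (nc_prolong \<omega> v) m) \<oplus>\<^bsub>P\<^esub>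
    monomial K {#v#} \<otimes>\<^bsub>P\<^esub> nc_D_monomial K \<Omega> X \<omega> m"
proof -
  let ?S = "set_mset (add_mset v m)"
  let ?T = "\<lambda>u m. monomial K (add_mset (nc_prolong \<omega> u) (m - {#u#}))"
  let ?y = "monomial K {#v#}"
  let ?z = "monomial K (add_mset (nc_prolong \<omega> v) m)"
  have S: "u \<in> \<Delta>" if "u \<in> ?S" for u
    using that v m by auto
  have T: "?T u m \<in> carrier P" if "u \<in> ?S" for u
    using S[OF that] \<omega> m by (intro prolonged_monomial_closed)
  have y: "?y \<in> carrier P" and z: "?z \<in> carrier P"
    using v m \<omega> by (auto intro!: monomial_closed simp: nc_prolong_closed)
  have term_eq: "[count (add_mset v m) u] \<cdot>\<^bsub>P\<^esub> ?T u (add_mset v m) =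
      (if v = u then ?z else \<zero>\<^bsub>P\<^esub>) \<oplus>\<^bsub>P\<^esub> ?y \<otimes>\<^bsub>P\<^esub> ([count m u] \<cdot>\<^bsub>P\<^esub> ?T u m)"
    if u: "u \<in> ?S" for u
  proof -
    have "?y \<otimes>\<^bsub>P\<^esub> ([count m u] \<cdot>\<^bsub>P\<^esub> ?T u m) = [count m u] \<cdot>\<^bsub>P\<^esub> ?T u (add_mset v m)"
    \<comment> \<open>Multiset subtraction is truncated, so \<open>v\<close> can be moved out of the
      difference when \<open>u\<close> occurs in \<open>m\<close>. Otherwise
      \<open>count m u\<close> is 0 and both sides vanish.\<close>
    proof (cases "u \<in># m")
      case True
      then have "add_mset v m - {#u#} = add_mset v (m - {#u#})"
        by (simp add: add_mset_diff_bothsides multiset_eq_iff)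
      then show ?thesis
        using y T[OF u] by (simp add: P.add_pow_rdistr monomial_mult add_mset_commute)
    next
      case False
      then show ?thesis
        using y by (simp add: not_in_iff)
    qed
    moreover have "?T u (add_mset v m) \<in> carrier P"
      using S[OF u] \<omega> v m by (intro prolonged_monomial_closed) auto
    \<comment> \<open>For \<open>u = v\<close> the multiplicity rises by one, and the additional
      term is \<open>?z\<close> because \<open>add_mset v m - {#v#}\<close> is
      \<open>m\<close>.\<close>
    ultimately show ?thesis
      using z by (auto simp: P.a_comm)
  qed
  have "nc_D_monomial K \<Omega> X \<omega> (add_mset v m) =
      (\<Oplus>\<^bsub>P\<^esub>u\<in>?S. (if v = u then ?z else \<zero>\<^bsub>P\<^esub>) \<oplus>\<^bsub>P\<^esub> ?y \<otimes>\<^bsub>P\<^esub> ([count m u] \<cdot>\<^bsub>P\<^esub> ?T u m))"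
    unfolding nc_D_monomial_def nc_diff_poly_def
    using T y z by (intro P.finsum_cong' term_eq) auto
  also have "\<dots> = (\<Oplus>\<^bsub>P\<^esub>u\<in>?S. if v = u then ?z else \<zero>\<^bsub>P\<^esub>) \<oplus>\<^bsub>P\<^esub>
      (\<Oplus>\<^bsub>P\<^esub>u\<in>?S. ?y \<otimes>\<^bsub>P\<^esub> ([count m u] \<cdot>\<^bsub>P\<^esub> ?T u m))"
    using T y z by (intro P.finsum_addf) auto
  also have "(\<Oplus>\<^bsub>P\<^esub>u\<in>?S. if v = u then ?z else \<zero>\<^bsub>P\<^esub>) = ?z"
    using z by (intro P.finsum_singleton) auto
  also have "(\<Oplus>\<^bsub>P\<^esub>u\<in>?S. ?y \<otimes>\<^bsub>P\<^esub> ([count m u] \<cdot>\<^bsub>P\<^esub> ?T u m)) =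
      ?y \<otimes>\<^bsub>P\<^esub> (\<Oplus>\<^bsub>P\<^esub>u\<in>?S. [count m u] \<cdot>\<^bsub>P\<^esub> ?T u m)"
    using T y by (intro P.finsum_rdistr[symmetric]) auto
  also have "(\<Oplus>\<^bsub>P\<^esub>u\<in>?S. [count m u] \<cdot>\<^bsub>P\<^esub> ?T u m) = nc_D_monomial K \<Omega> X \<omega> m"
    unfolding nc_D_monomial_def nc_diff_poly_def
    using T by (intro P.add.finprod_mono_neutral_cong_right) (auto simp: not_in_iff)
  finally show ?thesis .
qed

lemma nc_D_eq_linear_extension:
  "nc_D K \<Omega> X \<omega> = linear_extension K P (nc_D_monomial K \<Omega> X \<omega>)"
  by (simp add: fun_eq_iff nc_D_def linear_extension_def nc_diff_poly_def)

lemma nc_incl_closed: "x \<in> X \<Longrightarrow> nc_incl K x \<in> carrier P"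
  unfolding nc_incl_def variable_def by (rule monomial_closed) (simp add: nc_Delta_def)

context
  fixes \<omega> :: 'w
  assumes \<omega>: "\<omega> \<in> \<Omega>"
begin

interpretation D: monomial_extension K \<Delta> P "nc_D_monomial K \<Omega> X \<omega>"
  by unfold_locales (rule nc_D_monomial_closed[OF \<omega>])

abbreviation D where "D \<equiv> nc_D K \<Omega> X \<omega>"

lemmas D_closed = D.linear_extension_closed[folded nc_D_eq_linear_extension]
  and D_add = D.linear_extension_add[folded nc_D_eq_linear_extension]
  and D_smult = D.linear_extension_smult[folded nc_D_eq_linear_extension]
  and D_zero = D.linear_extension_zero[folded nc_D_eq_linear_extension]
  and D_monomial = D.linear_extension_monomial[folded nc_D_eq_linear_extension]

lemma D_monomial_add_mset:
  assumes "v \<in> \<Delta>" "set_mset m \<subseteq> \<Delta>"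
  shows "D (monomial K (add_mset v m)) =
    monomial K (add_mset (nc_prolong \<omega> v) m) \<oplus>\<^bsub>P\<^esub> monomial K {#v#} \<otimes>\<^bsub>P\<^esub> D (monomial K m)"
  using assms \<omega> by (simp add: D_monomial nc_D_monomial_add_mset)

text \<open>Induction on \<open>a\<close>: the recursion is applied to
  \<open>add_mset v (a + b)\<close> and to \<open>add_mset v a\<close>, and distributivity and
  associativity match the terms.\<close>

lemma D_monomial_mult:
  assumes "set_mset a \<subseteq> \<Delta>" "set_mset b \<subseteq> \<Delta>"
  shows "D (monomial K (a + b)) =
    D (monomial K a) \<otimes>\<^bsub>P\<^esub> monomial K b \<oplus>\<^bsub>P\<^esub> monomial K a \<otimes>\<^bsub>P\<^esub> D (monomial K b)"
  using assms
proof (induction a)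
  case empty
  then show ?case
    using P.l_one[of "D (monomial K b)"]
    by (simp add: D_monomial nc_D_monomial_empty nc_D_monomial_closed[OF \<omega>] one_eq_monomial)
next
  case (add v a)
  then have v: "v \<in> \<Delta>" "nc_prolong \<omega> v \<in> \<Delta>" and a: "set_mset a \<subseteq> \<Delta>" and b: "set_mset b \<subseteq> \<Delta>"
    by (auto simp: nc_prolong_closed[OF \<omega>])
  let ?v = "monomial K {#v#}" and ?v' = "monomial K {#nc_prolong \<omega> v#}"
  let ?a = "monomial K a" and ?b = "monomial K b"
  have closed: "?v \<in> carrier P" "?v' \<in> carrier P" "?a \<in> carrier P" "?b \<in> carrier P"
    "D ?a \<in> carrier P" "D ?b \<in> carrier P"
    using v a b by (auto intro!: D_closed)
  have "D (monomial K (add_mset v a + b)) =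
      ?v' \<otimes>\<^bsub>P\<^esub> (?a \<otimes>\<^bsub>P\<^esub> ?b) \<oplus>\<^bsub>P\<^esub> ?v \<otimes>\<^bsub>P\<^esub> (D ?a \<otimes>\<^bsub>P\<^esub> ?b \<oplus>\<^bsub>P\<^esub> ?a \<otimes>\<^bsub>P\<^esub> D ?b)"
    using v a b add.IH by (simp add: D_monomial_add_mset monomial_mult)
  also have "\<dots> = (?v' \<otimes>\<^bsub>P\<^esub> ?a \<oplus>\<^bsub>P\<^esub> ?v \<otimes>\<^bsub>P\<^esub> D ?a) \<otimes>\<^bsub>P\<^esub> ?b \<oplus>\<^bsub>P\<^esub> (?v \<otimes>\<^bsub>P\<^esub> ?a) \<otimes>\<^bsub>P\<^esub> D ?b"
    using closed by (simp add: P.l_distr P.r_distr P.m_assoc P.a_assoc)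
  also have "\<dots> = D (monomial K (add_mset v a)) \<otimes>\<^bsub>P\<^esub> ?b \<oplus>\<^bsub>P\<^esub> monomial K (add_mset v a) \<otimes>\<^bsub>P\<^esub> D ?b"
    using v a by (simp add: D_monomial_add_mset monomial_mult)
  finally show ?case .
qed

text \<open>Both sides are bilinear, so the rule spreads from monomials to arbitrary
  \<open>q\<close> and then to arbitrary \<open>p\<close>.\<close>

lemma D_mult:
  assumes "p \<in> carrier P" "q \<in> carrier P"
  shows "D (p \<otimes>\<^bsub>P\<^esub> q) = D p \<otimes>\<^bsub>P\<^esub> q \<oplus>\<^bsub>P\<^esub> p \<otimes>\<^bsub>P\<^esub> D q"
proof -
  note simps = poly_mult_simps poly_mult_closed D_closed D_zero D_add D_smult P.smult_r_distr
  have 1: "D (monomial K a \<otimes>\<^bsub>P\<^esub> q) = D (monomial K a) \<otimes>\<^bsub>P\<^esub> q \<oplus>\<^bsub>P\<^esub> monomial K a \<otimes>\<^bsub>P\<^esub> D q"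
    if "set_mset a \<subseteq> \<Delta>" for a
    using assms(2) that
    by (induction rule: poly_induct) (simp_all add: simps D_monomial_mult P.a_ac)
  show ?thesis
    using assms(1) assms(2)
    by (induction rule: poly_induct) (simp_all add: simps 1 P.a_ac)
qed

lemma derivation_D: "derivation K P D"
  unfolding derivation_def by (simp add: D_closed D_add D_smult D_mult)

end

end
section \<open>The universal property\<close>

locale differential_evaluation = differential_polynomials K \<Omega> X + A: algebra K A
  for K :: "('k, 'r) ring_scheme" (structure) and \<Omega> :: "'w set" and X :: "'x set"
    and A :: "('k, 'a, 'm) module_scheme" +
  fixes \<delta> :: "'w \<Rightarrow> 'a \<Rightarrow> 'a" and f :: "'x \<Rightarrow> 'a"
  assumes \<delta>: "\<omega> \<in> \<Omega> \<Longrightarrow> derivation K A (\<delta> \<omega>)" and f: "f \<in> X \<rightarrow> carrier A"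
begin

section \<open>Derivations of the target algebra and the values forced on monomials\<close>

lemma \<delta>_closed: "\<omega> \<in> \<Omega> \<Longrightarrow> x \<in> carrier A \<Longrightarrow> \<delta> \<omega> x \<in> carrier A"
  using \<delta>[of \<omega>] by (auto simp: derivation_def)

lemma
  assumes "\<omega> \<in> \<Omega>" "x \<in> carrier A" "y \<in> carrier A"
  shows \<delta>_add: "\<delta> \<omega> (x \<oplus>\<^bsub>A\<^esub> y) = \<delta> \<omega> x \<oplus>\<^bsub>A\<^esub> \<delta> \<omega> y"
    and \<delta>_mult: "\<delta> \<omega> (x \<otimes>\<^bsub>A\<^esub> y) = \<delta> \<omega> x \<otimes>\<^bsub>A\<^esub> y \<oplus>\<^bsub>A\<^esub> x \<otimes>\<^bsub>A\<^esub> \<delta> \<omega> y"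
  using \<delta>[OF assms(1)] assms(2,3) by (auto simp: derivation_def)

lemma \<delta>_smult:
  "\<omega> \<in> \<Omega> \<Longrightarrow> c \<in> carrier K \<Longrightarrow> x \<in> carrier A \<Longrightarrow> \<delta> \<omega> (c \<odot>\<^bsub>A\<^esub> x) = c \<odot>\<^bsub>A\<^esub> \<delta> \<omega> x"
  using \<delta>[of \<omega>] by (auto simp: derivation_def)

lemma \<delta>_zero: "\<omega> \<in> \<Omega> \<Longrightarrow> \<delta> \<omega> \<zero>\<^bsub>A\<^esub> = \<zero>\<^bsub>A\<^esub>"
  using \<delta>_smult[of \<omega> \<zero> "\<zero>\<^bsub>A\<^esub>"] \<delta>_closed[of \<omega> "\<zero>\<^bsub>A\<^esub>"] by simp

text \<open>The Leibniz rule for the product of \<open>\<one>\<close> with itself shows that the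
  value equals its own double, so it cancels to zero.\<close>

lemma \<delta>_one: "\<omega> \<in> \<Omega> \<Longrightarrow> \<delta> \<omega> \<one>\<^bsub>A\<^esub> = \<zero>\<^bsub>A\<^esub>"
  using \<delta>_mult[of \<omega> "\<one>\<^bsub>A\<^esub>" "\<one>\<^bsub>A\<^esub>"] \<delta>_closed[of \<omega> "\<one>\<^bsub>A\<^esub>"]
  by (simp add: A.add.r_cancel_one')

text \<open>The right fold makes the first letter of the word the outermost operator, in agreement
  with \<open>nc_prolong\<close>, which puts the new letter in front.\<close>

definition \<phi> where "\<phi> v = foldr \<delta> (fst v) (f (snd v))"

definition E where "E m = (\<Otimes>\<^bsub>A\<^esub>u\<in>set_mset m. \<phi> u [^]\<^bsub>A\<^esub> count m u)"

lemma \<phi>_closed: "v \<in> \<Delta> \<Longrightarrow> \<phi> v \<in> carrier A"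
proof (induction "fst v" arbitrary: v)
  case Nil
  then show ?case
    using f by (auto simp: \<phi>_def nc_Delta_def)
next
  case (Cons \<omega> w)
  have "\<phi> (w, snd v) \<in> carrier A"
    using Cons.prems Cons.hyps(2)[symmetric]
    by (intro Cons.hyps(1)) (auto simp: nc_Delta_def)
  then show ?case
    using Cons.prems Cons.hyps(2)[symmetric] by (auto simp: \<phi>_def nc_Delta_def \<delta>_closed)
qed

lemma \<phi>_prolong: "\<phi> (nc_prolong \<omega> v) = \<delta> \<omega> (\<phi> v)"
  by (simp add: \<phi>_def nc_prolong_def)

lemma E_closed: "set_mset m \<subseteq> \<Delta> \<Longrightarrow> E m \<in> carrier A"
  unfolding E_def by (intro A.finprod_closed Pi_I A.nat_pow_closed \<phi>_closed) auto

lemma E_empty: "E {#} = \<one>\<^bsub>A\<^esub>"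
  by (simp add: E_def)

lemma E_add_mset: "v \<in> \<Delta> \<Longrightarrow> set_mset m \<subseteq> \<Delta> \<Longrightarrow> E (add_mset v m) = \<phi> v \<otimes>\<^bsub>A\<^esub> E m"
  unfolding E_def by (intro A.finprod_count_add_mset \<phi>_closed) auto

lemma E_union: "set_mset a \<subseteq> \<Delta> \<Longrightarrow> set_mset b \<subseteq> \<Delta> \<Longrightarrow> E (a + b) = E a \<otimes>\<^bsub>A\<^esub> E b"
  by (induction a) (simp_all add: E_empty E_add_mset E_closed \<phi>_closed A.m_assoc)

sublocale L: monomial_extension K \<Delta> A E
  by unfold_locales (rule E_closed)

lemma L_mult:
  assumes "p \<in> carrier P" "q \<in> carrier P"
  shows "L.L (p \<otimes>\<^bsub>P\<^esub> q) = L.L p \<otimes>\<^bsub>A\<^esub> L.L q"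
proof -
  \<comment> \<open>The algebra axiom moves scalars out of the left factor only; commutativity
    supplies the other side.\<close>
  have smult_right: "x \<otimes>\<^bsub>A\<^esub> (c \<odot>\<^bsub>A\<^esub> y) = c \<odot>\<^bsub>A\<^esub> (x \<otimes>\<^bsub>A\<^esub> y)"
    if "c \<in> carrier K" "x \<in> carrier A" "y \<in> carrier A" for c x y
    using that A.smult_assoc2[of c y x] by (simp add: A.m_comm)
  note simps = poly_mult_simps poly_mult_closed L.linear_extension_zero L.linear_extension_add
    L.linear_extension_smult L.linear_extension_closed L.linear_extension_monomial E_closed
    A.l_distr A.r_distr A.smult_assoc2 smult_right
  have 1: "L.L (monomial K a \<otimes>\<^bsub>P\<^esub> q) = E a \<otimes>\<^bsub>A\<^esub> L.L q" if "set_mset a \<subseteq> \<Delta>" for a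
    using assms(2) that by (induction rule: poly_induct) (simp_all add: simps E_union)
  show ?thesis
    using assms(1) assms(2) by (induction rule: poly_induct) (simp_all add: simps 1)
qed

text \<open>Both sides obey the same Leibniz recursion in the number of factors, and they agree on
  variables since \<open>\<phi> (nc_prolong \<omega> v) = \<delta> \<omega> (\<phi> v)\<close>. The
  empty monomial is the case \<open>\<delta>_one\<close>.\<close>

lemma L_D_monomial:
  assumes \<omega>: "\<omega> \<in> \<Omega>" and "set_mset m \<subseteq> \<Delta>"
  shows "L.L (nc_D K \<Omega> X \<omega> (monomial K m)) = \<delta> \<omega> (E m)"
  using assms(2)
proof (induction m)
  case empty
  then show ?case
    using \<omega> by (simp add: D_monomial nc_D_monomial_empty L.linear_extension_zero E_empty \<delta>_one)
next
  case (add v m)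
  then have v: "v \<in> \<Delta>" "nc_prolong \<omega> v \<in> \<Delta>" and m: "set_mset m \<subseteq> \<Delta>"
    using nc_prolong_closed[OF \<omega>] by auto
  have "L.L (nc_D K \<Omega> X \<omega> (monomial K (add_mset v m))) =
      E (add_mset (nc_prolong \<omega> v) m) \<oplus>\<^bsub>A\<^esub> E {#v#} \<otimes>\<^bsub>A\<^esub> \<delta> \<omega> (E m)"
    using v m \<omega> add.IH
    by (simp add: D_monomial_add_mset D_closed poly_mult_closed L_mult
        L.linear_extension_add L.linear_extension_monomial)
  also have "\<dots> = \<delta> \<omega> (\<phi> v) \<otimes>\<^bsub>A\<^esub> E m \<oplus>\<^bsub>A\<^esub> \<phi> v \<otimes>\<^bsub>A\<^esub> \<delta> \<omega> (E m)"
    using v m by (simp add: E_add_mset E_empty \<phi>_prolong \<phi>_closed)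
  also have "\<dots> = \<delta> \<omega> (E (add_mset v m))"
    using v m \<omega> by (simp add: E_add_mset \<delta>_mult \<phi>_closed E_closed)
  finally show ?case .
qed

lemma L_D:
  assumes "\<omega> \<in> \<Omega>" and "p \<in> carrier P"
  shows "L.L (nc_D K \<Omega> X \<omega> p) = \<delta> \<omega> (L.L p)"
  using assms(2,1)
  by (induction rule: poly_induct)
    (simp_all add: D_zero D_add D_smult D_closed L.linear_extension_zero L.linear_extension_add
      L.linear_extension_smult L.linear_extension_closed L.linear_extension_monomial
      L_D_monomial E_closed \<delta>_zero \<delta>_add \<delta>_smult)

lemma ex_hom:
  "\<exists>h. h \<in> nc_multi_diff_hom K \<Omega> P (nc_D K \<Omega> X) A \<delta> \<and> (\<forall>x\<in>X. h (nc_incl K x) = f x)"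
proof (intro exI conjI ballI)
  \<comment> \<open>Homomorphisms are required to be extensional, hence the restriction.\<close>
  let ?h = "restrict L.L (carrier P)"
  have "?h \<in> ring_hom P A"
  proof (rule ring_hom_memI)
    show "?h \<one>\<^bsub>P\<^esub> = \<one>\<^bsub>A\<^esub>"
      by (simp add: one_eq_monomial L.linear_extension_monomial E_empty)
  qed (simp_all add: L.linear_extension_closed L.linear_extension_add L_mult poly_mult_closed)
  then show "?h \<in> nc_multi_diff_hom K \<Omega> P (nc_D K \<Omega> X) A \<delta>"
    by (simp add: nc_multi_diff_hom_def L.linear_extension_smult D_closed L_D)
  fix x
  assume x: "x \<in> X"
  then have "([], x) \<in> \<Delta>" "f x \<in> carrier A"
    using f by (auto simp: nc_Delta_def)
  then have "L.L (nc_incl K x) = f x"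
    using E_add_mset[of "([], x)" "{#}"]
    by (simp add: nc_incl_def variable_def L.linear_extension_monomial E_empty \<phi>_def)
  then show "?h (nc_incl K x) = f x"
    using nc_incl_closed[OF x] by simp
qed

section \<open>Uniqueness of the homomorphism\<close>

lemma hom_monomial:
  assumes h: "h \<in> nc_multi_diff_hom K \<Omega> P (nc_D K \<Omega> X) A \<delta>"
    and hf: "\<forall>x\<in>X. h (nc_incl K x) = f x" and m: "set_mset m \<subseteq> \<Delta>"
  shows "h (monomial K m) = E m"
proof -
  have hom: "h \<in> ring_hom P A"
    using h by (simp add: nc_multi_diff_hom_def)
  \<comment> \<open>Induction on the word: a variable with word \<open>\<omega> # w\<close> is the
    image under \<open>nc_D\<close> of the one with word \<open>w\<close>, so compatibility with the
    operators fixes its value once \<open>f\<close> fixes the case of the empty word.\<close>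
  have var: "(w, x) \<in> \<Delta> \<Longrightarrow> h (variable K (w, x)) = \<phi> (w, x)" for w x
  proof (induction w)
    case Nil
    then show ?case
      using hf by (simp add: nc_Delta_def nc_incl_def \<phi>_def)
  next
    case (Cons \<omega> w)
    then have \<omega>: "\<omega> \<in> \<Omega>" and w: "(w, x) \<in> \<Delta>"
      by (auto simp: nc_Delta_def)
    have closed: "variable K (w, x) \<in> carrier P"
      using w by (simp add: variable_def)
    \<comment> \<open>In the recursion with empty remainder the second summand vanishes, because the
      empty monomial has derivative zero.\<close>
    have "nc_D K \<Omega> X \<omega> (variable K (w, x)) = variable K (\<omega> # w, x)"
      using \<omega> w P.r_zero D_monomial_add_mset[of \<omega> "(w, x)" "{#}"] nc_prolong_closed[OF \<omega> w]
      by (simp add: variable_def nc_prolong_def D_monomial nc_D_monomial_empty)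
    moreover have "h (nc_D K \<Omega> X \<omega> (variable K (w, x))) = \<delta> \<omega> (h (variable K (w, x)))"
      using h \<omega> closed by (simp add: nc_multi_diff_hom_def)
    ultimately show ?case
      using Cons.IH[OF w] by (simp add: \<phi>_def)
  qed
  show ?thesis
    using m
  proof (induction m)
    case empty
    then show ?case
      using ring_hom_one[OF hom] by (simp add: one_eq_monomial E_empty)
  next
    case (add v m)
    then have v: "v \<in> \<Delta>" and m: "set_mset m \<subseteq> \<Delta>"
      by auto
    have "h (monomial K (add_mset v m)) = h (variable K v \<otimes>\<^bsub>P\<^esub> monomial K m)"
      by (simp add: variable_def monomial_mult)
    also have "\<dots> = h (variable K v) \<otimes>\<^bsub>A\<^esub> h (monomial K m)"
      using v m by (intro ring_hom_mult[OF hom]) (simp_all add: variable_def)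
    also have "\<dots> = E (add_mset v m)"
      using v m add.IH var[of "fst v" "snd v"] by (simp add: E_add_mset)
    finally show ?case .
  qed
qed

text \<open>Two linear maps with the same values on monomials coincide on all polynomials.\<close>

lemma hom_eq_linear_extension:
  assumes h: "h \<in> nc_multi_diff_hom K \<Omega> P (nc_D K \<Omega> X) A \<delta>"
    and hf: "\<forall>x\<in>X. h (nc_incl K x) = f x" and p: "p \<in> carrier P"
  shows "h p = L.L p"
proof -
  have smult: "h (c \<odot>\<^bsub>P\<^esub> q) = c \<odot>\<^bsub>A\<^esub> h q" if "c \<in> carrier K" "q \<in> carrier P" for c q
    using h that by (auto simp: nc_multi_diff_hom_def)
  have hom: "h \<in> ring_hom P A"
    using h by (simp add: nc_multi_diff_hom_def)
  have zero: "h \<zero>\<^bsub>P\<^esub> = \<zero>\<^bsub>A\<^esub>"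
    using hom by (rule ring_hom_zero) (rule P.ring_axioms A.ring_axioms)+
  show ?thesis
    using p
    by (induction rule: poly_induct)
      (simp_all add: zero smult hom_monomial[OF h hf] ring_hom_add[OF hom]
        L.linear_extension_zero L.linear_extension_add L.linear_extension_smult
        L.linear_extension_monomial)
qed

lemma ex1_hom:
  "\<exists>!h. h \<in> nc_multi_diff_hom K \<Omega> P (nc_D K \<Omega> X) A \<delta> \<and> (\<forall>x\<in>X. h (nc_incl K x) = f x)"
proof (rule ex_ex1I[OF ex_hom])
  fix h h'
  assume h: "h \<in> nc_multi_diff_hom K \<Omega> P (nc_D K \<Omega> X) A \<delta> \<and> (\<forall>x\<in>X. h (nc_incl K x) = f x)"
    and h': "h' \<in> nc_multi_diff_hom K \<Omega> P (nc_D K \<Omega> X) A \<delta> \<and> (\<forall>x\<in>X. h' (nc_incl K x) = f x)"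
  then have "h \<in> extensional (carrier P)" "h' \<in> extensional (carrier P)"
    by (auto simp: nc_multi_diff_hom_def)
  moreover have "h p = h' p" if "p \<in> carrier P" for p
    using hom_eq_linear_extension[of h p] hom_eq_linear_extension[of h' p] h h' that by simp
  ultimately show "h = h'"
    by (rule extensionalityI)
qed

end

theorem theorem2p8:
  fixes K :: "('k, 'r) ring_scheme" and \<Omega> :: "'w set" and X :: "'x set"
  assumes "field K" and "\<Omega> \<noteq> {}" and "X \<noteq> {}"
  shows "nc_multi_diff_algebra K \<Omega> (nc_diff_poly K \<Omega> X) (nc_D K \<Omega> X) \<and>
    nc_incl K \<in> X \<rightarrow> carrier (nc_diff_poly K \<Omega> X) \<and>
    inj_on (nc_incl K :: 'x \<Rightarrow> ('w list \<times> 'x) multiset \<Rightarrow> 'k) X \<and>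
    (\<forall>(A :: ('k, 'a, 'm) module_scheme) (\<delta> :: 'w \<Rightarrow> 'a \<Rightarrow> 'a) (f :: 'x \<Rightarrow> 'a).
       nc_multi_diff_algebra K \<Omega> A \<delta> \<longrightarrow> f \<in> X \<rightarrow> carrier A \<longrightarrow>
       (\<exists>!h. h \<in> nc_multi_diff_hom K \<Omega> (nc_diff_poly K \<Omega> X) (nc_D K \<Omega> X) A \<delta> \<and>
             (\<forall>x\<in>X. h (nc_incl K x) = f x)))"
proof -
  interpret K: field K by fact
  interpret differential_polynomials K \<Omega> X
    by unfold_locales
  have alg: "nc_multi_diff_algebra K \<Omega> P (nc_D K \<Omega> X)"
    by (simp add: nc_multi_diff_algebra_def algebra_poly_algebra derivation_D)
  have inj: "inj_on (nc_incl K :: 'x \<Rightarrow> ('w list \<times> 'x) multiset \<Rightarrow> 'k) X"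
  proof (rule inj_onI)
    fix x y :: 'x
    assume "nc_incl K x = (nc_incl K y :: ('w list \<times> 'x) multiset \<Rightarrow> 'k)"
    \<comment> \<open>The coefficient at this one-factor monomial separates the variables: it is
      \<open>\<one>\<close> on the left and, for \<open>x \<noteq> y\<close>, \<open>\<zero>\<close>
      on the right, and these differ in a field.\<close>
    then have "nc_incl K x {#([] :: 'w list, x)#} = nc_incl K y {#([] :: 'w list, x)#}"
      by (rule fun_cong)
    then show "x = y"
      by (auto simp: nc_incl_def variable_def monomial_def split: if_splits)
  qed
  have univ: "\<exists>!h. h \<in> nc_multi_diff_hom K \<Omega> P (nc_D K \<Omega> X) A \<delta> \<and>
      (\<forall>x\<in>X. h (nc_incl K x) = f x)"
    if "nc_multi_diff_algebra K \<Omega> A \<delta>" "f \<in> X \<rightarrow> carrier A"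
    for A :: "('k, 'a, 'm) module_scheme" and \<delta> f
  proof -
    interpret A: algebra K A
      using that(1) by (simp add: nc_multi_diff_algebra_def)
    interpret differential_evaluation K \<Omega> X A \<delta> f
      by unfold_locales (use that in \<open>auto simp: nc_multi_diff_algebra_def\<close>)
    show ?thesis
      by (rule ex1_hom)
  qed
  show ?thesis
    using alg inj univ nc_incl_closed unfolding nc_diff_poly_def by blast
qed

end
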